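(* Let $\mathcal{H}$ and $\mathcal{K}$ be real Hilbert spaces, let $f:\mathcal{H}\to\mathbb{R}$ be convex and differentiable with $L_{\nabla f}$-Lipschitz continuous gradient, let $g:\mathcal{K}\to\mathbb{R}$ be convex and $L_g$-Lipschitz continuous, let $K:\mathcal{H}\to\mathcal{K}$ be a nonzero linear continuous operator, put $F(x)=f(x)+g(Kx)$ for $x\in\mathcal{H}$, and let $x^*\in\mathcal{H}$ be an optimal solution of $\inf_{x\in\mathcal{H}}\{f(x)+g(Kx)\}$. Let $b>0$ and set $\mu_k=\frac{1}{bk}$ for all $k\ge1$. Let $x_0\in\mathcal{H}$ be arbitrary, and let $(x_k)_{k\ge1}\subseteq\mathcal{H}$ be generated by the following iteration: $t_1=1$, $y_1=x_0$, and for $k\ge1$ $$L_k=L_{\nabla f}+\frac{\|K\|^2}{\mu_k},\qquad x_k=y_k-\frac{1}{L_k}\left(\nabla f(y_k)+K^*\,\mathrm{Prox}_{\frac{1}{\mu_k}g^*}\left(\frac{Ky_k}{\mu_k}\right)\right),$$ $$t_{k+1}=\frac{1+\sqrt{1+4t_k^2}}{2},\qquad y_{k+1}=x_k+\frac{t_k-1}{t_{k+1}}(x_k-x_{k-1}).$$ Then for all $k\ge1$ $$F(x_{k+1})-F(x^* )\le\frac{2(L_{\nabla f}+b\|K\|^2)}{k+2}\|x_0-x^*\|^2+\frac{2(1+\ln(k+1))}{k+2}\cdot\frac{L_g^2(L_{\nabla f}+b\|K\|^2)}{b^2\|K\|^2},$$ and thus the objective values converge to the optimal value with rate $F(x_k)-F(x^*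 )=\mathcal{O}\left(\frac{\ln k}{k}\right)$.
   Context: For a function $h$ on a real Hilbert space $\mathcal{X}$, $h^*(p)=\sup_{x\in\mathcal{X}}\{\langle p,x\rangle-h(x)\}$ denotes its (Fenchel) conjugate. For a proper, convex, lower semicontinuous $h:\mathcal{X}\to\mathbb{R}\cup\{+\infty\}$ and $\gamma>0$, $\mathrm{Prox}_{\gamma h}(x)$ denotes the unique minimizer over $y\in\mathcal{X}$ of $h(y)+\frac{1}{2\gamma}\|y-x\|^2$. Differentiability is in the Fréchet sense. $K^*$ is the adjoint operator of $K$ and $\|K\|$ its operator norm. *)

theory Defs
  imports "HOL-Analysis.Analysis"
begin

text \<open>
  A real Hilbert space is a type of sort \<open>{real_inner, complete_space}\<close>. The definitions
  below need only the inner product.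
\<close>

text \<open>
  The description is meaningful wherever \<open>f\<close> is differentiable: the gradient is then unique,
  and in a Hilbert space it exists by the Riesz representation theorem.
\<close>
definition gradient :: "('a::real_inner \<Rightarrow> real) \<Rightarrow> 'a \<Rightarrow> 'a" where
  "gradient f x = (THE D. GDERIV f x :> D)"

text \<open>Extended-real valued, since conjugates of finite functions may take the value \<open>\<infinity>\<close>.\<close>
definition conjugate :: "('a::real_inner \<Rightarrow> ereal) \<Rightarrow> 'a \<Rightarrow> ereal" where
  "conjugate h p = (SUP x. ereal (p \<bullet> x) - h x)"

text \<open>
  \<open>prox \<gamma> h x\<close> is the minimizer, over the whole space, of
  \<open>h y + (norm (y - x))\<^sup>2 / (2 * \<gamma>)\<close>; it exists and is unique for \<open>\<gamma> > 0\<close> and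
  proper, convex, lower semicontinuous \<open>h\<close> on a Hilbert space.
\<close>
definition prox :: "real \<Rightarrow> ('a::real_inner \<Rightarrow> ereal) \<Rightarrow> 'a \<Rightarrow> 'a" where
  "prox \<gamma> h x =
    (THE y. is_arg_min (\<lambda>y. h y + ereal (1 / (2 * \<gamma>) * (norm (y - x))\<^sup>2)) (\<lambda>_. True) y)"

end

theory Submission
  imports Defs
begin

text \<open>
  The Moreau envelope of \<open>g\<close> with parameter \<open>\<mu>\<close> has \<open>Prox (g* / \<mu>) (v / \<mu>)\<close> as gradient at \<open>v\<close>,
  which is \<open>1 / \<mu>\<close>-Lipschitz, and it lies within \<open>\<mu> * L_g\<^sup>2 / 2\<close> below \<open>g\<close>. So step \<open>k\<close> is an
  accelerated gradient step for the smoothed objective \<open>\<Phi> k\<close>. With \<open>D k\<close> the smoothed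
  optimality gap shifted by \<open>\<mu> k * L_g\<^sup>2 / 2\<close> (which makes it nonnegative) and
  \<open>R k = \<parallel>t k x k - (t k - 1) x (k - 1) - xstar\<parallel>\<^sup>2\<close>, the energy \<open>(t k)\<^sup>2 * D k / L k + R k / 2\<close>
  increases by at most \<open>t k * \<mu> k * L_g\<^sup>2 / (2 * L k) = O(1 / k)\<close> per step, because \<open>L k\<close> increases.
  The logarithm is the harmonic sum of these increments.
\<close>

section \<open>Subgradients and existence of proximal points\<close>

definition subgradient :: "('a::real_inner \<Rightarrow> real) \<Rightarrow> 'a \<Rightarrow> 'a \<Rightarrow> bool" where
  "subgradient g p q \<longleftrightarrow> (\<forall>w. g p + q \<bullet> (w - p) \<le> g w)"

text \<open>The quadratic term makes the objective strongly convex, so minimizing sequences are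
  Cauchy; completeness gives a limit and continuity of \<open>g\<close> makes it a
  minimizer.\<close>

lemma ex_minimizer_lipschitz_plus_quadratic:
  fixes g :: "'a::{real_inner, complete_space} \<Rightarrow> real"
  assumes conv: "convex_on UNIV g" and lip: "C-lipschitz_on UNIV g" and \<mu>: "\<mu> > 0"
  obtains p where "\<And>w. g p + (norm (p - v))\<^sup>2 / (2 * \<mu>) \<le> g w + (norm (w - v))\<^sup>2 / (2 * \<mu>)"
proof -
  define \<phi> where "\<phi> w = g w + (norm (w - v))\<^sup>2 / (2 * \<mu>)" for w
  \<comment> \<open>The Lipschitz bound lets \<open>g\<close> drop at most linearly; completing the
    square in \<open>norm (w - v)\<close> bounds the total drop.\<close>
  have lower: "\<phi> w \<ge> g v - \<mu> * C\<^sup>2 / 2" for w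
  proof -
    have "\<bar>g w - g v\<bar> \<le> C * norm (w - v)"
      using lipschitz_onD[OF lip, of w v] by (simp add: dist_norm)
    moreover have "0 \<le> (norm (w - v) - \<mu> * C)\<^sup>2 / (2 * \<mu>)"
      using \<mu> by simp
    moreover have "(norm (w - v) - \<mu> * C)\<^sup>2 / (2 * \<mu>)
        = (norm (w - v))\<^sup>2 / (2 * \<mu>) - C * norm (w - v) + \<mu> * C\<^sup>2 / 2"
      using \<mu> by (simp add: field_simps power2_eq_square)
    ultimately show ?thesis unfolding \<phi>_def by linarith
  qed
  define m where "m = (INF w. \<phi> w)"
  have bdd: "bdd_below (range \<phi>)"
    using lower by (intro bdd_belowI2)
  have m_le: "m \<le> \<phi> w" for w
    unfolding m_def by (rule cINF_lower[OF bdd]) simp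
  \<comment> \<open>Compare \<open>m\<close> with the value at the midpoint \<open>c\<close>:
    convexity of \<open>g\<close> and the parallelogram law leave the squared distance as
    surplus.\<close>
  have close: "(norm (w - w'))\<^sup>2 \<le> 4 * \<mu> * (\<phi> w + \<phi> w' - 2 * m)" for w w'
  proof -
    define c where "c = (1 - 1/2) *\<^sub>R w + (1/2) *\<^sub>R w'"
    have "g c \<le> (1 - 1/2) * g w + (1/2) * g w'"
      unfolding c_def by (rule convex_onD[OF conv]) auto
    moreover have "(norm (c - v))\<^sup>2
        = (norm (w - v))\<^sup>2 / 2 + (norm (w' - v))\<^sup>2 / 2 - (norm (w - w'))\<^sup>2 / 4"
      unfolding c_def by (simp only: power2_norm_eq_inner inner_add_left inner_add_right inner_diff_left inner_diff_right inner_scaleR_left inner_scaleR_right)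
        (simp add: inner_commute field_simps power2_eq_square)
    then have "(norm (c - v))\<^sup>2 / (2 * \<mu>) = (norm (w - v))\<^sup>2 / (2 * \<mu>) / 2
        + (norm (w' - v))\<^sup>2 / (2 * \<mu>) / 2 - (norm (w - w'))\<^sup>2 / (8 * \<mu>)"
      by (simp add: add_divide_distrib diff_divide_distrib)
    ultimately have "\<phi> c \<le> \<phi> w / 2 + \<phi> w' / 2 - (norm (w - w'))\<^sup>2 / (8 * \<mu>)"
      unfolding \<phi>_def by (simp add: add_divide_distrib)
    with m_le[of c] have "(norm (w - w'))\<^sup>2 / (8 * \<mu>) \<le> (\<phi> w + \<phi> w' - 2 * m) / 2"
      by simp
    then show ?thesis using \<mu> by (simp add: field_simps)
  qed
  have "\<exists>w. \<phi> w < m + 1 / real (Suc n)" for n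
    using cINF_less_iff[OF _ bdd, of "m + 1 / real (Suc n)"] unfolding m_def by auto
  then obtain w where w: "\<And>n. \<phi> (w n) < m + 1 / real (Suc n)"
    by metis
  have "Cauchy w"
  proof (rule metric_CauchyI)
    fix e :: real assume e: "e > 0"
    \<comment> \<open>Two excesses of \<open>e\<^sup>2 / (8 * \<mu>)\<close> turn the bound in
      \<open>close\<close> into exactly \<open>e\<^sup>2\<close>.\<close>
    then obtain N where N: "1 / real (Suc N) < e\<^sup>2 / (8 * \<mu>)"
      using \<mu> reals_Archimedean[of "e\<^sup>2 / (8 * \<mu>)"] by (auto simp: inverse_eq_divide)
    have small: "\<phi> (w n) < m + e\<^sup>2 / (8 * \<mu>)" if "n \<ge> N" for n
    proof -
      have "1 / real (Suc n) \<le> 1 / real (Suc N)"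
        using that by (intro divide_left_mono) auto
      with w[of n] N show ?thesis by linarith
    qed
    have "dist (w i) (w j) < e" if "i \<ge> N" "j \<ge> N" for i j
    proof -
      have "(norm (w i - w j))\<^sup>2 \<le> 4 * \<mu> * (\<phi> (w i) + \<phi> (w j) - 2 * m)"
        by (rule close)
      also have "\<dots> < 4 * \<mu> * (e\<^sup>2 / (4 * \<mu>))"
        using small[OF that(1)] small[OF that(2)] \<mu>
        by (intro mult_strict_left_mono) (auto simp: field_simps)
      also have "\<dots> = e\<^sup>2" using \<mu> by simp
      finally show ?thesis
        using e by (simp add: dist_norm power2_less_imp_less)
    qed
    then show "\<exists>M. \<forall>i\<ge>M. \<forall>j\<ge>M. dist (w i) (w j) < e" by blast
  qed
  then obtain p where p: "w \<longlonglongrightarrow> p"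
    using Cauchy_convergent convergent_def by blast
  have "isCont g p"
    using lipschitz_on_continuous_on[OF lip] by (simp add: continuous_on_eq_continuous_at)
  then have "(\<lambda>n. \<phi> (w n)) \<longlonglongrightarrow> \<phi> p"
    unfolding \<phi>_def using \<mu> by (auto intro!: tendsto_intros p isCont_tendsto_compose[OF _ p])
  moreover have "(\<lambda>n. m + 1 / real (Suc n)) \<longlonglongrightarrow> m + 0"
    by (intro tendsto_intros LIMSEQ_Suc[OF lim_1_over_n])
  ultimately have "\<phi> p \<le> m"
    using LIMSEQ_le[of "\<lambda>n. \<phi> (w n)" "\<phi> p" "\<lambda>n. m + 1 / real (Suc n)" "m + 0"] w
    by (auto intro: less_imp_le)
  then have "\<phi> p \<le> \<phi> w" for w using m_le[of w] by linarith
  then show thesis using that unfolding \<phi>_def by blast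
qed

text \<open>Compare \<open>p\<close> with the point at parameter \<open>s\<close> on the segment
  towards \<open>w\<close>, divide by \<open>s\<close> and let \<open>s\<close> tend to 0: the
  quadratic remainder vanishes.\<close>

lemma minimizer_imp_subgradient:
  fixes g :: "'a::real_inner \<Rightarrow> real"
  assumes conv: "convex_on UNIV g" and \<mu>: "\<mu> > 0"
    and min: "\<And>w. g p + (norm (p - v))\<^sup>2 / (2 * \<mu>) \<le> g w + (norm (w - v))\<^sup>2 / (2 * \<mu>)"
  shows "subgradient g p ((1 / \<mu>) *\<^sub>R (v - p))"
  unfolding subgradient_def
proof
  fix w
  let ?q = "(1 / \<mu>) *\<^sub>R (v - p)" and ?e = "(norm (w - p))\<^sup>2 / (2 * \<mu>)"
  have *: "g p + ?q \<bullet> (w - p) \<le> g w + s * ?e" if s: "0 < s" "s \<le> 1" for s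
  proof -
    define c where "c = (1 - s) *\<^sub>R p + s *\<^sub>R w"
    have "g c \<le> (1 - s) * g p + s * g w"
      unfolding c_def using s by (intro convex_onD[OF conv]) auto
    moreover have "(norm (c - v))\<^sup>2
        = (norm (p - v))\<^sup>2 - 2 * s * ((v - p) \<bullet> (w - p)) + s\<^sup>2 * (norm (w - p))\<^sup>2"
      unfolding c_def
      by (simp only: power2_norm_eq_inner inner_add_left inner_add_right inner_diff_left inner_diff_right inner_scaleR_left inner_scaleR_right)
        (simp add: inner_commute field_simps power2_eq_square)
    then have "(norm (c - v))\<^sup>2 / (2 * \<mu>)
        = (norm (p - v))\<^sup>2 / (2 * \<mu>) - s * (?q \<bullet> (w - p)) + s * (s * ?e)"
      unfolding inner_scaleR_left using \<mu> by (simp add: field_simps power2_eq_square)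
    ultimately have "s * (g p + ?q \<bullet> (w - p)) \<le> s * (g w + s * ?e)"
      using min[of c] by (simp only: distrib_left left_diff_distrib)
    then show ?thesis using s by simp
  qed
  have "((\<lambda>s. g w + s * ?e) \<longlongrightarrow> g w + 0 * ?e) (at_right 0)"
    by (intro tendsto_intros)
  moreover have "\<forall>\<^sub>F s in at_right 0. g p + ?q \<bullet> (w - p) \<le> g w + s * ?e"
    using * by (auto simp: eventually_at_right_field intro!: exI[of _ 1])
  ultimately show "g p + ?q \<bullet> (w - p) \<le> g w"
    using tendsto_lowerbound[OF _ _ trivial_limit_at_right_real] by fastforce
qed

section \<open>Riesz representation, adjoints and gradients\<close>

text \<open>
  Convexity makes the minimizer of \<open>\<parallel>x\<parallel>\<^sup>2 / 2 - \<phi> x\<close> represent \<open>\<phi>\<close>, so no projection theorem is needed.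
\<close>
lemma Riesz_representation:
  fixes \<phi> :: "'a::{real_inner, complete_space} \<Rightarrow> real"
  assumes "bounded_linear \<phi>"
  obtains r where "\<And>x. \<phi> x = x \<bullet> r"
proof -
  interpret \<phi>: bounded_linear \<phi> by fact
  have conv: "convex_on UNIV (\<lambda>x. - \<phi> x)"
    by (rule convex_onI) (simp_all only: \<phi>.add \<phi>.scaleR convex_UNIV, simp add: algebra_simps)
  obtain C where "\<And>x. norm (\<phi> x) \<le> norm x * C" "C > 0"
    using \<phi>.pos_bounded by blast
  moreover have "dist (- \<phi> x) (- \<phi> y) = norm (\<phi> (x - y))" for x y
    by (simp add: dist_norm \<phi>.diff abs_minus_commute)
  ultimately have lip: "C-lipschitz_on UNIV (\<lambda>x. - \<phi> x)"
    by (intro lipschitz_onI) (simp_all add: dist_norm mult.commute)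
  obtain p where
    p: "\<And>w. - \<phi> p + (norm (p - 0))\<^sup>2 / (2 * 1) \<le> - \<phi> w + (norm (w - 0))\<^sup>2 / (2 * 1)"
    using ex_minimizer_lipschitz_plus_quadratic[OF conv lip, of 1 0] by auto
  have sub: "subgradient (\<lambda>x. - \<phi> x) p ((1 / 1) *\<^sub>R (0 - p))"
    by (rule minimizer_imp_subgradient[OF conv _ p]) simp
  have "\<phi> x \<le> x \<bullet> p" for x
    using sub[unfolded subgradient_def, rule_format, of "p + x"]
    by (simp add: \<phi>.add inner_commute)
  from this this[of "- x" for x] have "\<phi> x = x \<bullet> p" for x
    by (auto simp: linear_neg[OF \<phi>.linear] intro: antisym)
  then show thesis by (rule that)
qed

text \<open>\<open>adjoint\<close> chooses some map with this identity, so one must be exhibited: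
  for each \<open>z\<close>, Riesz represents the functional sending \<open>x\<close> to
  \<open>K x \<bullet> z\<close>.\<close>

lemma adjoint_inner:
  fixes K :: "'a::{real_inner, complete_space} \<Rightarrow> 'b::real_inner"
  assumes "bounded_linear K"
  shows "K x \<bullet> z = x \<bullet> adjoint K z"
proof -
  have "\<exists>r. \<forall>x. K x \<bullet> z = x \<bullet> r" for z
    using Riesz_representation[OF bounded_linear_compose[OF bounded_linear_inner_left assms], of z]
    by metis
  then have "\<exists>K'. \<forall>x z. K x \<bullet> z = x \<bullet> K' z" by metis
  then show ?thesis unfolding adjoint_def by (rule someI2_ex) blast
qed

text \<open>Justifies the description in \<open>gradient\<close>: Riesz yields a representing
  vector, and derivatives are unique.\<close>

lemma GDERIV_gradient:
  fixes f :: "'a::{real_inner, complete_space} \<Rightarrow> real"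
  assumes "f differentiable (at u)"
  shows "GDERIV f u :> gradient f u"
proof -
  obtain f' where f': "(f has_derivative f') (at u)"
    using assms by (auto simp: differentiable_def)
  obtain r where "\<And>h. f' h = h \<bullet> r"
    using Riesz_representation[OF has_derivative_bounded_linear[OF f']] by blast
  then have "f' = (\<lambda>h. h \<bullet> r)" by (rule ext)
  with f' have r: "GDERIV f u :> r"
    by (simp add: gderiv_def)
  show ?thesis unfolding gradient_def
  proof (rule theI[of _ r])
    fix s assume "GDERIV f u :> s"
    with r have "(\<lambda>h. h \<bullet> s) = (\<lambda>h. h \<bullet> r)"
      unfolding gderiv_def by (rule has_derivative_unique[rotated])
    then have "(s - r) \<bullet> s = (s - r) \<bullet> r" by metis
    then have "(s - r) \<bullet> (s - r) = 0" by (simp add: inner_diff_right)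
    then show "s = r" by simp
  qed (rule r)
qed

section \<open>First-order inequalities\<close>

lemma has_real_derivative_along_line:
  assumes "GDERIV f (u + s *\<^sub>R d) :> r"
  shows "((\<lambda>s. f (u + s *\<^sub>R d)) has_real_derivative r \<bullet> d) (at s)"
proof -
  have "((\<lambda>s. u + s *\<^sub>R d) has_derivative (\<lambda>h. h *\<^sub>R d)) (at s)"
    by (auto intro!: derivative_eq_intros)
  from has_derivative_compose[OF this, of f "\<lambda>h. h \<bullet> r"] assms
  show ?thesis
    by (simp add: gderiv_def has_field_derivative_def inner_commute mult_commute_abs)
qed

text \<open>On the line through \<open>u\<close> and \<open>w\<close> this is the tangent bound for
  convex functions of one real variable.\<close>

lemma convex_gradient_subgradient:
  fixes f :: "'a::{real_inner, complete_space} \<Rightarrow> real"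
  assumes conv: "convex_on UNIV f" and diff: "f differentiable (at u)"
  shows "subgradient f u (gradient f u)"
  unfolding subgradient_def
proof
  fix w
  let ?h = "\<lambda>s. f (u + s *\<^sub>R (w - u))"
  have "(?h has_real_derivative gradient f u \<bullet> (w - u)) (at 0)"
    by (rule has_real_derivative_along_line) (simp add: GDERIV_gradient diff)
  moreover have "convex_on UNIV ?h"
  proof (rule convex_onI)
    fix s a b :: real assume s: "0 < s" "s < 1"
    have "u + ((1 - s) *\<^sub>R a + s *\<^sub>R b) *\<^sub>R (w - u)
        = (1 - s) *\<^sub>R (u + a *\<^sub>R (w - u)) + s *\<^sub>R (u + b *\<^sub>R (w - u))"
      by (simp add: algebra_simps)
    then show "?h ((1 - s) *\<^sub>R a + s *\<^sub>R b) \<le> (1 - s) * ?h a + s * ?h b"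
      using convex_onD[OF conv, of s "u + a *\<^sub>R (w - u)" "u + b *\<^sub>R (w - u)"] s by auto
  qed simp
  ultimately have "?h 1 - ?h 0 \<ge> gradient f u \<bullet> (w - u) * (1 - 0)"
    by (intro convex_on_imp_above_tangent[of UNIV ?h 0]) auto
  then show "f u + gradient f u \<bullet> (w - u) \<le> f w" by simp
qed

text \<open>The descent lemma without integration: \<open>h\<close> is \<open>f\<close> on the
  segment minus the linear and quadratic terms of the model, and Cauchy-Schwarz with the Lipschitz
  bound makes its derivative nonpositive.\<close>

lemma lipschitz_gradient_upper_bound:
  fixes f :: "'a::{real_inner, complete_space} \<Rightarrow> real"
  assumes diff: "\<And>u. f differentiable (at u)" and lip: "C-lipschitz_on UNIV (gradient f)"
  shows "f w \<le> f u + gradient f u \<bullet> (w - u) + C / 2 * (norm (w - u))\<^sup>2"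
proof -
  let ?d = "w - u"
  define h where "h s = f (u + s *\<^sub>R ?d) - s * (gradient f u \<bullet> ?d) - C / 2 * s\<^sup>2 * (norm ?d)\<^sup>2" for s
  have deriv: "(h has_real_derivative
      gradient f (u + s *\<^sub>R ?d) \<bullet> ?d - gradient f u \<bullet> ?d - C * s * (norm ?d)\<^sup>2) (at s)" for s
    unfolding h_def
    by (auto intro!: derivative_eq_intros has_real_derivative_along_line GDERIV_gradient diff)
  have "h 1 \<le> h 0"
  proof (rule DERIV_nonpos_imp_nonincreasing[of 0 1 h])
    fix s :: real assume s: "0 \<le> s" "s \<le> 1"
    have "gradient f (u + s *\<^sub>R ?d) \<bullet> ?d - gradient f u \<bullet> ?d
        \<le> norm (gradient f (u + s *\<^sub>R ?d) - gradient f u) * norm ?d"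
      by (metis inner_diff_left norm_cauchy_schwarz)
    also have "\<dots> \<le> (C * (s * norm ?d)) * norm ?d"
      using lipschitz_onD[OF lip, of "u + s *\<^sub>R ?d" u] s
      by (intro mult_right_mono) (simp_all add: dist_norm)
    finally show "\<exists>y. (h has_real_derivative y) (at s) \<and> y \<le> 0"
      using deriv[of s] by (auto simp: power2_eq_square intro!: exI)
  qed simp
  then show ?thesis by (simp add: h_def)
qed

text \<open>Moving from \<open>p\<close> by \<open>q\<close> itself raises \<open>g\<close> by at
  least \<open>(norm q)\<^sup>2\<close>, but by at most \<open>C * norm q\<close>.\<close>

lemma subgradient_norm_le:
  fixes g :: "'a::real_inner \<Rightarrow> real"
  assumes "subgradient g p q" and lip: "C-lipschitz_on UNIV g"
  shows "norm q \<le> C"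
proof -
  have "g p + q \<bullet> ((p + q) - p) \<le> g (p + q)"
    using assms(1) unfolding subgradient_def by blast
  moreover have "\<bar>g (p + q) - g p\<bar> \<le> C * norm q"
    using lipschitz_onD[OF lip, of "p + q" p] by (simp add: dist_norm)
  ultimately have "norm q * norm q \<le> C * norm q"
    by (simp add: power2_norm_eq_inner flip: power2_eq_square)
  then show ?thesis
    using lipschitz_on_nonneg[OF lip] by (cases "q = 0") auto
qed

section \<open>Proximal points of the conjugate\<close>

definition prox_conj :: "real \<Rightarrow> ('a::real_inner \<Rightarrow> real) \<Rightarrow> 'a \<Rightarrow> 'a" where
  "prox_conj \<mu> g v = prox (1 / \<mu>) (conjugate (\<lambda>u. ereal (g u))) ((1 / \<mu>) *\<^sub>R v)"

text \<open>Fenchel-Young is an equality for \<open>q\<close> and \<open>?p\<close>, and an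
  inequality for every other \<open>y\<close>. Adding the quadratic leaves a gap
  \<open>\<mu> / 2 * (norm (y - q))\<^sup>2\<close>, which gives both minimality and uniqueness of
  \<open>q\<close>.\<close>

lemma prox_conj_eqI:
  fixes g :: "'a::real_inner \<Rightarrow> real"
  assumes \<mu>: "\<mu> > 0" and sub: "subgradient g (v - \<mu> *\<^sub>R q) q"
  shows "prox_conj \<mu> g v = q"
proof -
  let ?p = "v - \<mu> *\<^sub>R q"
  let ?c = "conjugate (\<lambda>u. ereal (g u))"
  let ?E = "\<lambda>y. (norm (y - (1 / \<mu>) *\<^sub>R v))\<^sup>2"
  let ?obj = "\<lambda>y. ?c y + ereal (1 / (2 * (1 / \<mu>)) * ?E y)"
  have conj_ge: "ereal (y \<bullet> ?p - g ?p) \<le> ?c y" for y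
    unfolding conjugate_def by (rule SUP_upper2[of ?p]) simp_all
  have conj_q: "?c q = ereal (q \<bullet> ?p - g ?p)"
  proof (rule antisym[OF _ conj_ge])
    have "q \<bullet> w - g w \<le> q \<bullet> ?p - g ?p" for w
      using sub unfolding subgradient_def by (smt (verit) inner_diff_right)
    then show "?c q \<le> ereal (q \<bullet> ?p - g ?p)"
      unfolding conjugate_def by (intro SUP_least) simp
  qed
  \<comment> \<open>Expansion about \<open>q\<close>, where the quadratic has gradient
    \<open>- ?p\<close>; this linear term cancels the one from Fenchel-Young.\<close>
  have quad: "\<mu> / 2 * ?E y = \<mu> / 2 * ?E q - (y - q) \<bullet> ?p + \<mu> / 2 * (norm (y - q))\<^sup>2" for y
    using \<mu> by (simp only: power2_norm_eq_inner inner_add_left inner_add_right inner_diff_left inner_diff_right inner_scaleR_left inner_scaleR_right)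
        (simp add: inner_commute field_simps power2_eq_square)
  have ge: "?obj q + ereal (\<mu> / 2 * (norm (y - q))\<^sup>2) \<le> ?obj y" for y
  proof -
    have "?obj q + ereal (\<mu> / 2 * (norm (y - q))\<^sup>2)
        = ereal (y \<bullet> ?p - g ?p) + ereal (\<mu> / 2 * ?E y)"
      unfolding conj_q quad[of y] by (simp add: inner_diff_left)
    also have "\<dots> \<le> ?obj y"
      using add_right_mono[OF conj_ge[of y], of "ereal (\<mu> / 2 * ?E y)"] by simp
    finally show ?thesis .
  qed
  \<comment> \<open>Finiteness at \<open>q\<close> permits cancelling \<open>?obj q\<close> in the
    extended reals.\<close>
  have fin: "?obj q = ereal (q \<bullet> ?p - g ?p + \<mu> / 2 * ?E q)"
    unfolding conj_q by simp
  have min_q: "is_arg_min ?obj (\<lambda>_. True) q"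
    unfolding is_arg_min_linorder
  proof (intro conjI allI impI TrueI)
    fix y
    have "?obj q \<le> ?obj q + ereal (\<mu> / 2 * (norm (y - q))\<^sup>2)"
      unfolding fin using \<mu> by simp
    with ge[of y] show "?obj q \<le> ?obj y" by (rule order_trans[rotated])
  qed
  show ?thesis
    unfolding prox_conj_def prox_def
  proof (rule the_equality, rule min_q)
    fix y assume "is_arg_min ?obj (\<lambda>_. True) y"
    then have "?obj y \<le> ?obj q" by (simp add: is_arg_min_linorder)
    with ge[of y] have "?obj q + ereal (\<mu> / 2 * (norm (y - q))\<^sup>2) \<le> ?obj q"
      by (rule order_trans)
    then have "\<mu> / 2 * (norm (y - q))\<^sup>2 \<le> 0" unfolding fin by simp
    then show "y = q" using \<mu> by (simp add: mult_le_0_iff)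
  qed
qed

text \<open>Moreau decomposition: the primal proximal point \<open>p\<close> of \<open>v\<close>
  yields the subgradient \<open>(1 / \<mu>) *\<^sub>R (v - p)\<close>, which
  \<open>prox_conj_eqI\<close> identifies with the dual one.\<close>

lemma subgradient_prox_conj:
  fixes g :: "'a::{real_inner, complete_space} \<Rightarrow> real"
  assumes conv: "convex_on UNIV g" and lip: "C-lipschitz_on UNIV g" and \<mu>: "\<mu> > 0"
  shows "subgradient g (v - \<mu> *\<^sub>R prox_conj \<mu> g v) (prox_conj \<mu> g v)"
proof -
  obtain p where
    "\<And>w. g p + (norm (p - v))\<^sup>2 / (2 * \<mu>) \<le> g w + (norm (w - v))\<^sup>2 / (2 * \<mu>)"
    using ex_minimizer_lipschitz_plus_quadratic[OF conv lip \<mu>] by metis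
  then have sub: "subgradient g p ((1 / \<mu>) *\<^sub>R (v - p))" (is "subgradient g p ?q")
    by (rule minimizer_imp_subgradient[OF conv \<mu>])
  moreover have "p = v - \<mu> *\<^sub>R ?q" using \<mu> by simp
  ultimately have "subgradient g (v - \<mu> *\<^sub>R ?q) ?q" by metis
  with prox_conj_eqI[OF \<mu> this] show ?thesis by simp
qed

section \<open>The Moreau envelope\<close>

text \<open>
  The Moreau envelope \<open>inf\<^sub>w g w + \<parallel>w - v\<parallel>\<^sup>2 / (2 * \<mu>)\<close>, evaluated at its minimizer
  \<open>v - \<mu> *\<^sub>R prox_conj \<mu> g v\<close>.
\<close>
definition moreau :: "real \<Rightarrow> ('a::real_inner \<Rightarrow> real) \<Rightarrow> 'a \<Rightarrow> real" where
  "moreau \<mu> g v = g (v - \<mu> *\<^sub>R prox_conj \<mu> g v) + \<mu> / 2 * (norm (prox_conj \<mu> g v))\<^sup>2"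

context
  fixes g :: "'a::{real_inner, complete_space} \<Rightarrow> real" and C :: real
  assumes conv: "convex_on UNIV g" and lip: "C-lipschitz_on UNIV g"
begin

text \<open>The subgradient inequality at the proximal point of \<open>v\<close>, tested at
  \<open>w\<close>; the surplus is a complete square.\<close>

lemma moreau_le:
  assumes \<mu>: "\<mu> > 0"
  shows "moreau \<mu> g v \<le> g w + (norm (w - v))\<^sup>2 / (2 * \<mu>)"
proof -
  let ?q = "prox_conj \<mu> g v"
  have "g (v - \<mu> *\<^sub>R ?q) + ?q \<bullet> (w - (v - \<mu> *\<^sub>R ?q)) \<le> g w"
    using subgradient_prox_conj[OF conv lip \<mu>, of v] unfolding subgradient_def by blast
  moreover have "0 \<le> (norm (w - v + \<mu> *\<^sub>R ?q))\<^sup>2 / (2 * \<mu>)" using \<mu> by simp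
  moreover have "(norm (w - v + \<mu> *\<^sub>R ?q))\<^sup>2 / (2 * \<mu>)
      = (norm (w - v))\<^sup>2 / (2 * \<mu>) + ?q \<bullet> (w - (v - \<mu> *\<^sub>R ?q)) - \<mu> / 2 * (norm ?q)\<^sup>2"
    using \<mu> by (simp only: power2_norm_eq_inner inner_add_left inner_add_right inner_diff_left inner_diff_right inner_scaleR_left inner_scaleR_right)
        (simp add: inner_commute field_simps power2_eq_square)
  ultimately show ?thesis unfolding moreau_def by linarith
qed

lemma moreau_le_self: "\<mu> > 0 \<Longrightarrow> moreau \<mu> g v \<le> g v"
  using moreau_le[of \<mu> v v] by simp

text \<open>The subgradient inequality of \<open>g\<close> at the proximal point of
  \<open>v\<close>, tested at that of \<open>w\<close>, leaves a multiple of
  \<open>(norm (?r - ?q))\<^sup>2\<close>.\<close>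

lemma subgradient_moreau:
  assumes \<mu>: "\<mu> > 0"
  shows "subgradient (moreau \<mu> g) v (prox_conj \<mu> g v)"
  unfolding subgradient_def
proof
  fix w
  let ?q = "prox_conj \<mu> g v" and ?r = "prox_conj \<mu> g w"
  have "g (v - \<mu> *\<^sub>R ?q) + ?q \<bullet> ((w - \<mu> *\<^sub>R ?r) - (v - \<mu> *\<^sub>R ?q)) \<le> g (w - \<mu> *\<^sub>R ?r)"
    using subgradient_prox_conj[OF conv lip \<mu>, of v] unfolding subgradient_def by blast
  moreover have "0 \<le> \<mu> / 2 * (norm (?r - ?q))\<^sup>2" using \<mu> by simp
  moreover have "\<mu> / 2 * (norm (?r - ?q))\<^sup>2 = ?q \<bullet> ((w - \<mu> *\<^sub>R ?r) - (v - \<mu> *\<^sub>R ?q))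
      + \<mu> / 2 * (norm ?r)\<^sup>2 - \<mu> / 2 * (norm ?q)\<^sup>2 - ?q \<bullet> (w - v)"
    by (simp only: power2_norm_eq_inner inner_add_left inner_add_right inner_diff_left inner_diff_right inner_scaleR_left inner_scaleR_right)
        (simp add: inner_commute field_simps power2_eq_square)
  ultimately show "moreau \<mu> g v + ?q \<bullet> (w - v) \<le> moreau \<mu> g w"
    unfolding moreau_def by linarith
qed

text \<open>The proximal point of \<open>v\<close> is a candidate in the infimum at
  \<open>w\<close>. This gives the smoothness bound directly, without a Lipschitz estimate for the
  gradient.\<close>

lemma moreau_upper_bound:
  assumes \<mu>: "\<mu> > 0"
  shows "moreau \<mu> g w \<le> moreau \<mu> g v + prox_conj \<mu> g v \<bullet> (w - v) + (norm (w - v))\<^sup>2 / (2 * \<mu>)"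
proof -
  let ?q = "prox_conj \<mu> g v"
  have "(norm ((v - \<mu> *\<^sub>R ?q) - w))\<^sup>2 / (2 * \<mu>)
      = \<mu> / 2 * (norm ?q)\<^sup>2 + ?q \<bullet> (w - v) + (norm (w - v))\<^sup>2 / (2 * \<mu>)"
    using \<mu> by (simp only: power2_norm_eq_inner inner_add_left inner_add_right inner_diff_left inner_diff_right inner_scaleR_left inner_scaleR_right)
        (simp add: inner_commute field_simps power2_eq_square)
  with moreau_le[OF \<mu>, of w "v - \<mu> *\<^sub>R ?q"] show ?thesis unfolding moreau_def by linarith
qed

text \<open>The loss \<open>C * \<mu> * norm ?q - \<mu> / 2 * (norm ?q)\<^sup>2\<close> is largest
  at \<open>norm ?q = C\<close>.\<close>

lemma le_moreau_plus:
  assumes \<mu>: "\<mu> > 0"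
  shows "g v \<le> moreau \<mu> g v + \<mu> * C\<^sup>2 / 2"
proof -
  let ?q = "prox_conj \<mu> g v"
  have "\<bar>g v - g (v - \<mu> *\<^sub>R ?q)\<bar> \<le> C * (\<mu> * norm ?q)"
    using lipschitz_onD[OF lip, of v "v - \<mu> *\<^sub>R ?q"] \<mu> by (simp add: dist_norm)
  moreover have "0 \<le> \<mu> / 2 * (C - norm ?q)\<^sup>2" using \<mu> by simp
  moreover have "\<mu> / 2 * (C - norm ?q)\<^sup>2 = \<mu> * C\<^sup>2 / 2 - C * (\<mu> * norm ?q) + \<mu> / 2 * (norm ?q)\<^sup>2"
    by (simp add: field_simps power2_eq_square)
  ultimately show ?thesis unfolding moreau_def by linarith
qed

text \<open>The price of changing the smoothing between iterations. The subgradient inequality at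
  the proximal point for \<open>\<mu>'\<close> is tested at the one for \<open>\<mu>\<close>; the
  rest is controlled by \<open>norm ?r \<le> C\<close>.\<close>

lemma moreau_decrease_parameter:
  assumes \<mu>': "\<mu>' > 0" and le: "\<mu>' \<le> \<mu>"
  shows "moreau \<mu>' g v \<le> moreau \<mu> g v + (\<mu> - \<mu>') * C\<^sup>2 / 2"
proof -
  have \<mu>: "\<mu> > 0" using assms by simp
  let ?q = "prox_conj \<mu> g v" and ?r = "prox_conj \<mu>' g v"
  have sub: "subgradient g (v - \<mu>' *\<^sub>R ?r) ?r"
    by (rule subgradient_prox_conj[OF conv lip \<mu>'])
  then have "g (v - \<mu>' *\<^sub>R ?r) + ?r \<bullet> ((v - \<mu> *\<^sub>R ?q) - (v - \<mu>' *\<^sub>R ?r)) \<le> g (v - \<mu> *\<^sub>R ?q)"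
    unfolding subgradient_def by blast
  moreover have "0 \<le> \<mu> / 2 * (norm (?r - ?q))\<^sup>2" using \<mu> by simp
  moreover have "\<mu> / 2 * (norm (?r - ?q))\<^sup>2
      = ?r \<bullet> ((v - \<mu> *\<^sub>R ?q) - (v - \<mu>' *\<^sub>R ?r)) + \<mu> / 2 * (norm ?q)\<^sup>2
        - \<mu>' / 2 * (norm ?r)\<^sup>2 + (\<mu> - \<mu>') / 2 * (norm ?r)\<^sup>2"
    by (simp only: power2_norm_eq_inner inner_add_left inner_add_right inner_diff_left inner_diff_right inner_scaleR_left inner_scaleR_right)
        (simp add: inner_commute field_simps power2_eq_square)
  moreover have "(\<mu> - \<mu>') / 2 * (norm ?r)\<^sup>2 \<le> (\<mu> - \<mu>') / 2 * C\<^sup>2"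
    using subgradient_norm_le[OF sub lip] le by (intro mult_left_mono power_mono) auto
  ultimately show ?thesis unfolding moreau_def by simp
qed

end

section \<open>The gradient step and its acceleration\<close>

text \<open>Merges distance comparisons to \<open>x\<close> and to \<open>z\<close> into a single
  difference of squares, which can telescope along the iteration.\<close>

lemma extrapolation_identity:
  fixes x y x' z :: "'a::real_inner" and T :: real
  shows "(T\<^sup>2 - T) * ((norm (y - x))\<^sup>2 - (norm (x' - x))\<^sup>2)
      + T * ((norm (y - z))\<^sup>2 - (norm (x' - z))\<^sup>2)
    = (norm (T *\<^sub>R y - (T - 1) *\<^sub>R x - z))\<^sup>2 - (norm (T *\<^sub>R x' - (T - 1) *\<^sub>R x - z))\<^sup>2"
  by (simp only: power2_norm_eq_inner inner_add_left inner_add_right inner_diff_left inner_diff_right inner_scaleR_left inner_scaleR_right)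
        (simp add: inner_commute field_simps power2_eq_square)

text \<open>Both summands lie above their linearization at \<open>y\<close> and below it plus a
  quadratic; the curvatures add up to \<open>L\<close>.\<close>

lemma smoothed_gradient_step:
  fixes f :: "'h::{real_inner, complete_space} \<Rightarrow> real"
    and g :: "'k::{real_inner, complete_space} \<Rightarrow> real" and K :: "'h \<Rightarrow> 'k"
  assumes f_convex: "convex_on UNIV f" and f_diff: "\<And>u. f differentiable (at u)"
    and f_lip: "A-lipschitz_on UNIV (gradient f)"
    and g_convex: "convex_on UNIV g" and g_lip: "C-lipschitz_on UNIV g"
    and K: "bounded_linear K" and \<mu>: "\<mu> > 0"
    and L: "L = A + (onorm K)\<^sup>2 / \<mu>" and L_pos: "L > 0"
    and x: "x = y - (1 / L) *\<^sub>R (gradient f y + adjoint K (prox_conj \<mu> g (K y)))"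
  shows "f x + moreau \<mu> g (K x)
    \<le> f u + moreau \<mu> g (K u) + L / 2 * ((norm (y - u))\<^sup>2 - (norm (x - u))\<^sup>2)"
proof -
  let ?q = "prox_conj \<mu> g (K y)"
  define G where "G = gradient f y + adjoint K ?q"
  have q_K: "?q \<bullet> (K v - K y) = adjoint K ?q \<bullet> (v - y)" for v
    using adjoint_inner[OF K, of "v - y" ?q]
    by (simp add: linear_diff[OF bounded_linear.linear[OF K]] inner_commute)
  have f_lower: "f y + gradient f y \<bullet> (u - y) \<le> f u"
    using convex_gradient_subgradient[OF f_convex f_diff] unfolding subgradient_def by blast
  have g_lower: "moreau \<mu> g (K y) + adjoint K ?q \<bullet> (u - y) \<le> moreau \<mu> g (K u)"
    using subgradient_moreau[OF g_convex g_lip \<mu>, of "K y"] unfolding subgradient_def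
    by (metis q_K)
  have f_upper: "f x \<le> f y + gradient f y \<bullet> (x - y) + A / 2 * (norm (x - y))\<^sup>2"
    by (rule lipschitz_gradient_upper_bound[OF f_diff f_lip])
  have "norm (K x - K y) \<le> onorm K * norm (x - y)"
    using onorm[OF K, of "x - y"] by (simp add: linear_diff[OF bounded_linear.linear[OF K]])
  then have "(norm (K x - K y))\<^sup>2 \<le> (onorm K)\<^sup>2 * (norm (x - y))\<^sup>2"
    by (metis norm_ge_zero power_mono power_mult_distrib)
  then have "(norm (K x - K y))\<^sup>2 / (2 * \<mu>) \<le> (onorm K)\<^sup>2 * (norm (x - y))\<^sup>2 / (2 * \<mu>)"
    using \<mu> by (intro divide_right_mono) auto
  then have g_upper: "moreau \<mu> g (K x) \<le> moreau \<mu> g (K y) + adjoint K ?q \<bullet> (x - y)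
      + (onorm K)\<^sup>2 * (norm (x - y))\<^sup>2 / (2 * \<mu>)"
    using moreau_upper_bound[OF g_convex g_lip \<mu>, of "K x" "K y"] unfolding q_K by linarith
  have "L / 2 * (norm (x - y))\<^sup>2
      = A / 2 * (norm (x - y))\<^sup>2 + (onorm K)\<^sup>2 * (norm (x - y))\<^sup>2 / (2 * \<mu>)"
    unfolding L using \<mu> by (simp add: field_simps)
  moreover have "G \<bullet> (x - u) = gradient f y \<bullet> (x - y) + adjoint K ?q \<bullet> (x - y)
      - (gradient f y \<bullet> (u - y) + adjoint K ?q \<bullet> (u - y))"
    unfolding G_def by (simp add: inner_diff_right inner_add_left)
  ultimately have "f x + moreau \<mu> g (K x)
      \<le> f u + moreau \<mu> g (K u) + G \<bullet> (x - u) + L / 2 * (norm (x - y))\<^sup>2"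
    using f_lower g_lower f_upper g_upper by linarith
  \<comment> \<open>The step rule turns the linear term into a three-point identity.\<close>
  moreover have "G = L *\<^sub>R (y - x)" unfolding x G_def using L_pos by simp
  then have "G \<bullet> (x - u) + L / 2 * (norm (x - y))\<^sup>2
      = L / 2 * ((norm (y - u))\<^sup>2 - (norm (x - u))\<^sup>2)"
    by (simp only: power2_norm_eq_inner inner_diff_left inner_diff_right inner_scaleR_left)
      (simp add: inner_commute field_simps)
  ultimately show ?thesis by linarith
qed

text \<open>The step inequality at \<open>u = x\<close> with weight \<open>T\<^sup>2 - T\<close>,
  plus that at \<open>u = z\<close> with weight \<open>T\<close>.\<close>

lemma accelerated_step:
  fixes \<Phi> :: "'a::real_inner \<Rightarrow> real"
  assumes step: "\<And>u. \<Phi> x' \<le> \<Phi> u + L / 2 * ((norm (y - u))\<^sup>2 - (norm (x' - u))\<^sup>2)"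
    and T: "T \<ge> 1"
  shows "T\<^sup>2 * \<Phi> x' \<le> (T\<^sup>2 - T) * \<Phi> x + T * \<Phi> z
    + L / 2 * ((norm (T *\<^sub>R y - (T - 1) *\<^sub>R x - z))\<^sup>2 - (norm (T *\<^sub>R x' - (T - 1) *\<^sub>R x - z))\<^sup>2)"
proof -
  have "(T\<^sup>2 - T) * \<Phi> x' \<le> (T\<^sup>2 - T) * (\<Phi> x + L / 2 * ((norm (y - x))\<^sup>2 - (norm (x' - x))\<^sup>2))"
    using T by (intro mult_left_mono[OF step]) (simp add: power2_eq_square)
  moreover have "T * \<Phi> x' \<le> T * (\<Phi> z + L / 2 * ((norm (y - z))\<^sup>2 - (norm (x' - z))\<^sup>2))"
    using T by (intro mult_left_mono[OF step]) simp
  moreover have "(T\<^sup>2 - T) * (\<Phi> x + l * a) + T * (\<Phi> z + l * b)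
      = (T\<^sup>2 - T) * \<Phi> x + T * \<Phi> z + l * ((T\<^sup>2 - T) * a + T * b)" for a b l
    by (simp add: algebra_simps)
  ultimately show ?thesis
    unfolding extrapolation_identity[symmetric] left_diff_distrib[of "T\<^sup>2"] by (smt (verit))
qed

section \<open>Harmonic numbers and the momentum sequence\<close>

lemma harm_le_one_plus_ln: "harm (Suc n) \<le> 1 + ln (real (Suc n))"
  using decseq_harm_diff_ln[THEN decseqD, of 0 n] by (simp add: harm_def)

text \<open>Each step raises \<open>t\<close> by at least 1/2 and at most 1. The lower bound drives
  the rate, the upper one controls the increments of the energy.\<close>

lemma t_sequence_bounds:
  fixes t :: "nat \<Rightarrow> real"
  assumes t_1: "t 1 = 1"
    and t_step: "\<And>k. k \<ge> 1 \<Longrightarrow> t (k + 1) = (1 + sqrt (1 + 4 * (t k)\<^sup>2)) / 2"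
    and k: "k \<ge> 1"
  shows "(real k + 1) / 2 \<le> t k" "t k \<le> real k"
proof -
  have "(real k + 1) / 2 \<le> t k \<and> t k \<le> real k"
    using k
  proof (induction k rule: dec_induct)
    case (step n)
    have "2 * t n \<le> sqrt (1 + 4 * (t n)\<^sup>2)"
      by (rule real_le_rsqrt) (simp add: power2_eq_square)
    moreover have "sqrt (1 + 4 * (t n)\<^sup>2) \<le> 1 + 2 * t n"
      using step by (intro real_le_lsqrt) (simp_all add: power2_eq_square algebra_simps)
    ultimately show ?case using step t_step[of n] by simp
  qed (use t_1 in simp)
  then show "(real k + 1) / 2 \<le> t k" "t k \<le> real k" by auto
qed


theorem theorem3:
  fixes f :: "'h::{real_inner, complete_space} \<Rightarrow> real"
    and g :: "'k::{real_inner, complete_space} \<Rightarrow> real"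
    and K :: "'h \<Rightarrow> 'k"
    and F :: "'h \<Rightarrow> real"
    and L_f L_g b :: real
    and xstar x0 :: 'h
    and \<mu> L t :: "nat \<Rightarrow> real"
    and x y :: "nat \<Rightarrow> 'h"
  assumes f_convex: "convex_on UNIV f"
    and f_diff: "\<And>u. f differentiable (at u)"
    and f_grad_lipschitz: "L_f-lipschitz_on UNIV (gradient f)"
    and g_convex: "convex_on UNIV g"
    and g_lipschitz: "L_g-lipschitz_on UNIV g"
    and K_linear: "bounded_linear K"
    and K_nonzero: "K \<noteq> (\<lambda>u. 0)"
    and F_eq: "\<And>u. F u = f u + g (K u)"
    and xstar_optimal: "\<And>u. F xstar \<le> F u"
    and b_pos: "b > 0"
    and mu_eq: "\<And>k. k \<ge> 1 \<Longrightarrow> \<mu> k = 1 / (b * real k)"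
    and x_0: "x 0 = x0"
    and t_1: "t 1 = 1"
    and y_1: "y 1 = x0"
    and L_eq: "\<And>k. k \<ge> 1 \<Longrightarrow> L k = L_f + (onorm K)\<^sup>2 / \<mu> k"
    and x_step: "\<And>k. k \<ge> 1 \<Longrightarrow> x k = y k - (1 / L k) *\<^sub>R
        (gradient f (y k) +
         adjoint K (prox (1 / \<mu> k) (conjugate (\<lambda>v. ereal (g v))) ((1 / \<mu> k) *\<^sub>R K (y k))))"
    and t_step: "\<And>k. k \<ge> 1 \<Longrightarrow> t (k + 1) = (1 + sqrt (1 + 4 * (t k)\<^sup>2)) / 2"
    and y_step: "\<And>k. k \<ge> 1 \<Longrightarrow>
        y (k + 1) = x k + ((t k - 1) / t (k + 1)) *\<^sub>R (x k - x (k - 1))"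
  shows "(\<forall>k\<ge>1. F (x (k + 1)) - F xstar
            \<le> 2 * (L_f + b * (onorm K)\<^sup>2) / (real k + 2) * (norm (x0 - xstar))\<^sup>2
              + 2 * (1 + ln (real k + 1)) / (real k + 2)
                * (L_g\<^sup>2 * (L_f + b * (onorm K)\<^sup>2) / (b\<^sup>2 * (onorm K)\<^sup>2)))
         \<and> (\<lambda>k. F (x k)) \<longlonglongrightarrow> F xstar
         \<and> (\<lambda>k. F (x k) - F xstar) \<in> O(\<lambda>k. ln (real k) / real k)"
proof -

  \<comment> \<open>Parameter estimates\<close>
  have L_f_nonneg: "L_f \<ge> 0" using lipschitz_on_nonneg[OF f_grad_lipschitz] .
  have K_pos: "onorm K > 0" using onorm_pos_lt[OF K_linear] K_nonzero by auto
  have \<mu>_pos: "\<mu> k > 0" if "k \<ge> 1" for k using that b_pos by (simp add: mu_eq)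
  have \<mu>_mono: "\<mu> (k + 1) \<le> \<mu> k" if "k \<ge> 1" for k
    using that b_pos by (simp add: mu_eq frac_le)
  \<comment> \<open>\<open>c\<close> is the value of \<open>L 1\<close>; \<open>L k\<close> is
    affine in \<open>k\<close> and at most \<open>k\<close> times as large.\<close>
  define c where "c = L_f + b * (onorm K)\<^sup>2"
  have c_pos: "c > 0"
    unfolding c_def using L_f_nonneg b_pos K_pos by (intro add_nonneg_pos) auto
  have L_eq': "L k = L_f + b * real k * (onorm K)\<^sup>2" if "k \<ge> 1" for k
    using that by (simp add: L_eq mu_eq)
  have L_ge: "b * real k * (onorm K)\<^sup>2 \<le> L k" if "k \<ge> 1" for k
    using that L_f_nonneg by (simp add: L_eq')
  have L_pos: "L k > 0" if "k \<ge> 1" for k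
    using that b_pos K_pos by (intro less_le_trans[OF _ L_ge]) auto
  have L_mono: "L k \<le> L (k + 1)" if "k \<ge> 1" for k
    using that b_pos by (simp add: L_eq' algebra_simps)
  have L_le: "L k \<le> real k * c" if "k \<ge> 1" for k
    using that L_f_nonneg mult_right_mono[of 1 "real k" L_f]
    by (simp add: L_eq' c_def algebra_simps)
  note t_ge = t_sequence_bounds(1)[OF t_1 t_step] and t_le = t_sequence_bounds(2)[OF t_1 t_step]
  have t_ge_1: "t k \<ge> 1" if "k \<ge> 1" for k
    using t_ge[OF _ that] that by simp
  \<comment> \<open>The quadratic equation behind the square root: the weight on the old iterate at
    step \<open>k + 1\<close> is the weight the energy carried at step \<open>k\<close>.\<close>
  have t_sq: "(t (k + 1))\<^sup>2 - t (k + 1) = (t k)\<^sup>2" if "k \<ge> 1" for k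
  proof -
    have "(sqrt (1 + 4 * (t k)\<^sup>2))\<^sup>2 = 1 + 4 * (t k)\<^sup>2" by simp
    then show ?thesis unfolding t_step[OF that] by (simp add: power2_eq_square field_simps)
  qed

  \<comment> \<open>The smoothed objectives\<close>
  define \<Phi> where "\<Phi> k u = f u + moreau (\<mu> k) g (K u)" for k u
  have step: "\<Phi> k (x k) \<le> \<Phi> k u + L k / 2 * ((norm (y k - u))\<^sup>2 - (norm (x k - u))\<^sup>2)"
    if "k \<ge> 1" for k u
    unfolding \<Phi>_def
    by (rule smoothed_gradient_step[OF f_convex f_diff f_grad_lipschitz g_convex g_lipschitz
          K_linear \<mu>_pos[OF that] L_eq[OF that] L_pos[OF that]])
      (simp add: x_step[OF that] prox_conj_def)
  have \<Phi>_le: "\<Phi> k u \<le> F u" if "k \<ge> 1" for k u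
    unfolding \<Phi>_def F_eq using moreau_le_self[OF g_convex g_lipschitz \<mu>_pos[OF that]] by simp
  have F_le: "F u \<le> \<Phi> k u + \<mu> k * L_g\<^sup>2 / 2" if "k \<ge> 1" for k u
    unfolding \<Phi>_def F_eq
    using le_moreau_plus[OF g_convex g_lipschitz \<mu>_pos[OF that], of "K u"] by simp
  have \<Phi>_change: "\<Phi> (k + 1) u \<le> \<Phi> k u + (\<mu> k - \<mu> (k + 1)) * L_g\<^sup>2 / 2" if "k \<ge> 1" for k u
    unfolding \<Phi>_def
    using moreau_decrease_parameter[OF g_convex g_lipschitz \<mu>_pos \<mu>_mono[OF that], of "K u"]
    by simp

  \<comment> \<open>The energy inequality\<close>
  define D where "D k = \<Phi> k (x k) - F xstar + \<mu> k * L_g\<^sup>2 / 2" for k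
  define R where "R k = (norm (t k *\<^sub>R x k - (t k - 1) *\<^sub>R x (k - 1) - xstar))\<^sup>2" for k
  define E where "E k = (t k)\<^sup>2 * D k / L k + R k / 2" for k
  define \<epsilon> where "\<epsilon> k = t k * \<mu> k * L_g\<^sup>2 / (2 * L k)" for k
  have gap_le_D: "F (x k) - F xstar \<le> D k" if "k \<ge> 1" for k
    using F_le[OF that, of "x k"] unfolding D_def by simp
  have D_nonneg: "D k \<ge> 0" if "k \<ge> 1" for k
    using gap_le_D[OF that] xstar_optimal[of "x k"] by linarith
  \<comment> \<open>Since \<open>t 1 - 1 = 0\<close>, the term with \<open>x 0\<close> drops out of
    \<open>R 1\<close>.\<close>
  have E_1: "E 1 \<le> (norm (x0 - xstar))\<^sup>2 / 2 + \<epsilon> 1"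
  proof -
    have "D 1 \<le> \<mu> 1 * L_g\<^sup>2 / 2 + L 1 / 2 * ((norm (x0 - xstar))\<^sup>2 - R 1)"
      using step[of 1 xstar] \<Phi>_le[of 1 xstar] unfolding D_def R_def using t_1 y_1 x_0 by simp
    then have "D 1 / L 1 \<le> (\<mu> 1 * L_g\<^sup>2 / 2 + L 1 / 2 * ((norm (x0 - xstar))\<^sup>2 - R 1)) / L 1"
      using L_pos[of 1] by (intro divide_right_mono) auto
    also have "\<dots> = (norm (x0 - xstar))\<^sup>2 / 2 + \<epsilon> 1 - R 1 / 2"
      unfolding \<epsilon>_def t_1 using L_pos[of 1] by (simp add: field_simps)
    finally show ?thesis unfolding E_def t_1 by simp
  qed
  have E_step: "E (k + 1) \<le> E k + \<epsilon> (k + 1)" if k: "k \<ge> 1" for k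
  proof -
    let ?T = "t (k + 1)" and ?L = "L (k + 1)"
    define m where "m = \<mu> (k + 1) * L_g\<^sup>2 / 2"
    have T: "?T \<ge> 1" using t_ge_1[of "k + 1"] by simp
    have L: "?L > 0" using L_pos[of "k + 1"] by simp
    \<comment> \<open>The extrapolation coefficient is chosen so that the point before step
      \<open>k + 1\<close> is the one measured by \<open>R k\<close>.\<close>
    have "?T *\<^sub>R y (k + 1) = ?T *\<^sub>R x k + (t k - 1) *\<^sub>R (x k - x (k - 1))"
      unfolding y_step[OF k] using T by (simp add: scaleR_add_right)
    then have y_eq: "?T *\<^sub>R y (k + 1) - (?T - 1) *\<^sub>R x k = t k *\<^sub>R x k - (t k - 1) *\<^sub>R x (k - 1)"
      by (simp add: algebra_simps)
    have "?T\<^sup>2 * \<Phi> (k + 1) (x (k + 1)) \<le> (t k)\<^sup>2 * \<Phi> (k + 1) (x k) + ?T * \<Phi> (k + 1) xstar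
        + ?L / 2 * (R k - R (k + 1))"
      using accelerated_step[OF step[of "k + 1"] T, of "x k" xstar]
      unfolding R_def t_sq[OF k] y_eq by simp
    \<comment> \<open>The shift in \<open>D k\<close> pays for the change of smoothing and leaves
      exactly \<open>m\<close>.\<close>
    moreover have "(t k)\<^sup>2 * \<Phi> (k + 1) (x k) \<le> (t k)\<^sup>2 * (D k + F xstar - m)"
      using \<Phi>_change[OF k, of "x k"] unfolding D_def m_def
      by (intro mult_left_mono) (auto simp: algebra_simps diff_divide_distrib)
    moreover have "?T * \<Phi> (k + 1) xstar \<le> ?T * F xstar"
      using T by (intro mult_left_mono \<Phi>_le) auto
    ultimately have "?T\<^sup>2 * (D (k + 1) + F xstar - m)
        \<le> (t k)\<^sup>2 * (D k + F xstar - m) + ?T * F xstar + ?L / 2 * (R k - R (k + 1))"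
      unfolding D_def[of "k + 1"] m_def by simp
    \<comment> \<open>With these weights \<open>F xstar\<close> cancels and only
      \<open>?T * m\<close> survives, the source of \<open>\<epsilon> (k + 1)\<close>.\<close>
    moreover have "?T\<^sup>2 = (t k)\<^sup>2 + ?T" using t_sq[OF k] by simp
    ultimately have "?T\<^sup>2 * D (k + 1) \<le> (t k)\<^sup>2 * D k + ?T * m + ?L / 2 * (R k - R (k + 1))"
      by (simp add: algebra_simps)
    then have "?T\<^sup>2 * D (k + 1) / ?L
        \<le> ((t k)\<^sup>2 * D k + ?T * m + ?L / 2 * (R k - R (k + 1))) / ?L"
      using L by (intro divide_right_mono) auto
    also have "\<dots> = (t k)\<^sup>2 * D k / ?L + \<epsilon> (k + 1) + R k / 2 - R (k + 1) / 2"
      unfolding \<epsilon>_def m_def using L by (simp add: field_simps)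
    \<comment> \<open>Replacing \<open>?L\<close> by the smaller \<open>L k\<close> needs
      \<open>D k \<ge> 0\<close>, the purpose of the shift.\<close>
    also have "(t k)\<^sup>2 * D k / ?L \<le> (t k)\<^sup>2 * D k / L k"
      using D_nonneg[OF k] L_mono[OF k] L_pos[OF k] L by (intro divide_left_mono) auto
    finally show ?thesis unfolding E_def by simp
  qed
  have E_le: "E k \<le> (norm (x0 - xstar))\<^sup>2 / 2 + (\<Sum>j=1..k. \<epsilon> j)" if "k \<ge> 1" for k
    using that
  proof (induction k rule: dec_induct)
    case base
    then show ?case using E_1 by simp
  next
    case (step n)
    then show ?case using E_step[of n] by simp
  qed

  \<comment> \<open>Harmonic bound on the increments\<close>
  define d where "d = L_g\<^sup>2 / (b\<^sup>2 * (onorm K)\<^sup>2)"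
  have \<epsilon>_le: "\<epsilon> j \<le> d / 2 * inverse (real j)" if j: "j \<ge> 1" for j
  proof -
    \<comment> \<open>\<open>t j \<le> j\<close> cancels the decay of \<open>\<mu> j\<close>, so the
      factor \<open>1 / j\<close> comes from the growth of \<open>L j\<close>.\<close>
    have "\<epsilon> j \<le> real j * \<mu> j * L_g\<^sup>2 / (2 * (b * real j * (onorm K)\<^sup>2))"
      unfolding \<epsilon>_def using t_le[OF _ j] t_ge_1[OF j] L_ge[OF j] \<mu>_pos[OF j] j b_pos K_pos
      by (intro frac_le mult_right_mono) auto
    also have "\<dots> = d / 2 * inverse (real j)"
      unfolding mu_eq[OF j] d_def using j b_pos K_pos by (simp add: field_simps power2_eq_square)
    finally show ?thesis .
  qed
  have sum_\<epsilon>: "(\<Sum>j=1..k + 1. \<epsilon> j) \<le> d / 2 * (1 + ln (real k + 1))" for k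
  proof -
    have "(\<Sum>j=1..k + 1. \<epsilon> j) \<le> (\<Sum>j=1..k + 1. d / 2 * inverse (real j))"
      by (intro sum_mono \<epsilon>_le) auto
    also have "\<dots> = d / 2 * harm (Suc k)"
      by (simp only: harm_def sum_distrib_left Suc_eq_plus1)
    also have "\<dots> \<le> d / 2 * (1 + ln (real (Suc k)))"
      by (intro mult_left_mono harm_le_one_plus_ln) (simp add: d_def)
    finally show ?thesis by (simp add: add.commute)
  qed

  \<comment> \<open>The explicit rate\<close>
  define B where "B k = 2 * c / (real k + 2) * (norm (x0 - xstar))\<^sup>2
    + 2 * (1 + ln (real k + 1)) / (real k + 2) * (L_g\<^sup>2 * c / (b\<^sup>2 * (onorm K)\<^sup>2))" for k
  have bound: "F (x (k + 1)) - F xstar \<le> B k" if "k \<ge> 1" for k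
  proof -
    let ?S = "(norm (x0 - xstar))\<^sup>2 / 2 + d / 2 * (1 + ln (real k + 1))"
    have S: "?S \<ge> 0" unfolding d_def by simp
    have T: "(real k + 2) / 2 \<le> t (k + 1)" using t_ge[of "k + 1"] by simp
    have L: "L (k + 1) > 0" using L_pos[of "k + 1"] by simp
    have "(t (k + 1))\<^sup>2 * D (k + 1) / L (k + 1) \<le> E (k + 1)"
      unfolding E_def R_def by simp
    also have "\<dots> \<le> ?S" using E_le[of "k + 1"] sum_\<epsilon>[of k] by simp
    finally have "(t (k + 1))\<^sup>2 * D (k + 1) \<le> L (k + 1) * ?S"
      using L by (simp add: pos_divide_le_eq mult.commute)
    moreover have "((real k + 2) / 2)\<^sup>2 * D (k + 1) \<le> (t (k + 1))\<^sup>2 * D (k + 1)"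
      using T by (intro mult_right_mono power_mono D_nonneg) auto
    \<comment> \<open>\<open>L_le\<close> gives the factor \<open>k + 1\<close>; relaxing it to
      \<open>k + 2\<close> lets it cancel one factor of the squared bound on
      \<open>t (k + 1)\<close>.\<close>
    moreover have "L (k + 1) * ?S \<le> ((real k + 2) * c) * ?S"
      using L_le[of "k + 1"] c_pos by (intro mult_right_mono S) (simp add: algebra_simps)
    ultimately have "((real k + 2) / 2)\<^sup>2 * D (k + 1) \<le> (real k + 2) * c * ?S"
      by linarith
    then have "(real k + 2) * ((real k + 2) * D (k + 1)) \<le> (real k + 2) * (4 * c * ?S)"
      by (simp add: power2_eq_square field_simps)
    then have "(real k + 2) * D (k + 1) \<le> 4 * c * ?S"
      by (rule mult_left_le_imp_le) simp
    then have "D (k + 1) \<le> 4 * c * ?S / (real k + 2)"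
      by (simp add: pos_le_divide_eq mult.commute)
    also have "\<dots> = B k"
      unfolding B_def d_def using b_pos K_pos by (simp add: add_divide_distrib algebra_simps)
    finally show ?thesis using gap_le_D[of "k + 1"] by simp
  qed

  \<comment> \<open>Asymptotics\<close>
  have big_o: "(\<lambda>k. F (x k) - F xstar) \<in> O(\<lambda>k. ln (real k) / real k)"
  proof (rule bigoI)
    let ?C = "2 * c * (norm (x0 - xstar))\<^sup>2 + 4 * (L_g\<^sup>2 * c / (b\<^sup>2 * (onorm K)\<^sup>2))"
    show "\<forall>\<^sub>F k in sequentially. norm (F (x k) - F xstar) \<le> ?C * norm (ln (real k) / real k)"
    proof (rule eventually_sequentiallyI)
      fix k :: nat assume k: "k \<ge> 3"
      \<comment> \<open>From \<open>k = 3\<close> on, \<open>ln k \<ge> 1\<close>, so 1 is at most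
        \<open>ln k\<close> and \<open>1 + ln k\<close> at most \<open>2 * ln k\<close>; hence the 4
        in \<open>?C\<close>.\<close>
      have "exp 1 \<le> real k" using exp_le k by linarith
      then have ln: "1 \<le> ln (real k)" using k by (simp add: ln_ge_iff)
      have "F (x k) - F xstar \<le> B (k - 1)" using bound[of "k - 1"] k by simp
      also have "\<dots> = 2 * c * (norm (x0 - xstar))\<^sup>2 * (1 / (real k + 1))
          + 2 * (L_g\<^sup>2 * c / (b\<^sup>2 * (onorm K)\<^sup>2)) * ((1 + ln (real k)) / (real k + 1))"
        unfolding B_def using k by (simp add: of_nat_diff algebra_simps)
      also have "\<dots> \<le> 2 * c * (norm (x0 - xstar))\<^sup>2 * (ln (real k) / real k)
          + 2 * (L_g\<^sup>2 * c / (b\<^sup>2 * (onorm K)\<^sup>2)) * (2 * ln (real k) / real k)"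
        using ln k c_pos by (intro add_mono mult_left_mono frac_le) auto
      also have "\<dots> = ?C * (ln (real k) / real k)" by (simp add: algebra_simps)
      finally show "norm (F (x k) - F xstar) \<le> ?C * norm (ln (real k) / real k)"
        using xstar_optimal[of "x k"] ln k by simp
    qed
  qed
  moreover have "(\<lambda>k. F (x k)) \<longlonglongrightarrow> F xstar"
  proof -
    have "(\<lambda>k. F (x k) - F xstar) \<longlonglongrightarrow> 0"
      using smalloD_tendsto[OF landau_o.big_small_trans[OF big_o smalloI_tendsto[of _ "\<lambda>_. 1"]]]
        lim_ln_over_n by simp
    then show ?thesis by (simp add: LIM_zero_iff)
  qed
  ultimately show ?thesis using bound unfolding B_def c_def by auto
qed

end
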